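(* For every (non-zero) type $I_2$ JBW$^*$-algebra $\mathfrak{J}$ there exists a positive finitely additive measure $\mu:\mathcal{P}(\mathfrak{J})\to\mathbb{R}$ which does not admit an extension to a bounded linear functional on $\mathfrak{J}$.
   Context: A JB$^*$-algebra is a complex Jordan-Banach algebra $(\mathfrak{J},\circ)$ (commutative product, $(a^2\circ b)\circ a=(a\circ b)\circ a^2$, $\|a\circ b\|\le\|a\|\|b\|$) with a conjugate-linear algebra involution $^*$ satisfying $\|U_a(a^* )\|=\|a\|^3$, where $U_{a,c}(b)=(a\circ b)\circ c+(b\circ c)\circ a-(a\circ c)\circ b$ and $U_a=U_{a,a}$. A JBW$^*$-algebra is a JB$^*$-algebra which is a dual Banach space; it has a unit $\mathbf{1}$. A projection is $p\in\mathfrak{J}$ with $p^*=p=p\circ p$; $\mathcal{P}(\mathfrak{J})$ is the set of projections. A positive finitely additive measure is a map $\mu:\mathcal{P}(\mathfrak{J})\to\mathbb{R}$ with $\mu(p)\ge0$ for all $p$ and $\mu(p+q)=\mu(p)+\mu(q)$ whenever $p\circ q=0$. The centre consists of those $z$ with $(z\circ c)\circ b=z\circ(c\circ b)$ for all $b,c$; the central cover of a projection $p$ is the smallest central projection dominating $p$. A projection $p$ is abelian if $U_p(\mathfrak{J})$ is associative. $\mathfrak{J}$ is of type $I_2$ if there are two orthogonal abelian projections $p_1,p_2$, each with central cover $\mathbf{1}$, such that $p_1+p_2=\mathbf{1}$. *)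

theory Defs
  imports "HOL-Analysis.Bounded_Linear_Function"
begin

section \<open>Complex Banach spaces and their duals\<close>

text \<open>The distribution has no class of complex normed spaces.  A complex Banach space is a type of
  class \<^class>\<open>banach\<close> with a complex scalar multiplication that extends the real one and for which
  the norm is homogeneous.\<close>

locale complex_banach = vector_space scaleC
  for scaleC :: "complex \<Rightarrow> 'a::banach \<Rightarrow> 'a" +
  assumes scaleC_of_real: "scaleC (complex_of_real r) x = r *\<^sub>R x"
    and norm_scaleC: "norm (scaleC c x) = cmod c * norm x"

definition bounded_complex_functional ::
    "(complex \<Rightarrow> 'a::banach \<Rightarrow> 'a) \<Rightarrow> ('a \<Rightarrow> complex) \<Rightarrow> bool" where
  "bounded_complex_functional scaleC f \<longleftrightarrow>
     bounded_linear f \<and> (\<forall>c x. f (scaleC c x) = c * f x)"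

definition complex_dual :: "(complex \<Rightarrow> 'x::banach \<Rightarrow> 'x) \<Rightarrow> ('x \<Rightarrow>\<^sub>L complex) set" where
  "complex_dual scaleX = {f. bounded_complex_functional scaleX (blinfun_apply f)}"

text \<open>\<open>T\<close> is a complex-linear isometry of the space on \<open>'a\<close> onto the dual of the space on \<open>'x\<close>;
  the norm on \<open>'x \<Rightarrow>\<^sub>L complex\<close> is the operator norm.\<close>

definition isometric_iso_onto_dual ::
    "(complex \<Rightarrow> 'a::banach \<Rightarrow> 'a) \<Rightarrow> (complex \<Rightarrow> 'x::banach \<Rightarrow> 'x)
      \<Rightarrow> ('a \<Rightarrow> 'x \<Rightarrow>\<^sub>L complex) \<Rightarrow> bool" where
  "isometric_iso_onto_dual scaleC scaleX T \<longleftrightarrow>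
     (\<forall>a b. T (a + b) = T a + T b) \<and>
     (\<forall>c a x. blinfun_apply (T (scaleC c a)) x = c * blinfun_apply (T a) x) \<and>
     (\<forall>a. norm (T a) = norm a) \<and>
     bij_betw T UNIV (complex_dual scaleX)"


section \<open>JB*-algebras and JBW*-algebras\<close>

text \<open>\<open>jordan_U m a c b\<close> is $U_{a,c}(b)$ for the product \<open>m\<close>.\<close>

definition jordan_U :: "('a \<Rightarrow> 'a \<Rightarrow> 'a) \<Rightarrow> 'a \<Rightarrow> 'a \<Rightarrow> 'a \<Rightarrow> 'a::ab_group_add" where
  "jordan_U m a c b = m (m a b) c + m (m b c) a - m (m a c) b"

locale jb_star_algebra = complex_banach scaleC
  for scaleC :: "complex \<Rightarrow> 'a::banach \<Rightarrow> 'a" +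
  fixes jprod :: "'a \<Rightarrow> 'a \<Rightarrow> 'a"  (infixl \<open>\<odot>\<close> 70)
    and star :: "'a \<Rightarrow> 'a"
  assumes jprod_commute: "a \<odot> b = b \<odot> a"
    and jprod_add_left: "(a + b) \<odot> c = a \<odot> c + b \<odot> c"
    and jprod_scaleC_left: "scaleC l a \<odot> b = scaleC l (a \<odot> b)"
    and jordan_identity: "((a \<odot> a) \<odot> b) \<odot> a = (a \<odot> b) \<odot> (a \<odot> a)"
    and norm_jprod: "norm (a \<odot> b) \<le> norm a * norm b"
    and star_star: "star (star a) = a"
    and star_add: "star (a + b) = star a + star b"
    and star_scaleC: "star (scaleC l a) = scaleC (cnj l) (star a)"
    and star_jprod: "star (a \<odot> b) = star a \<odot> star b"
    and norm_U_star: "norm (jordan_U (\<odot>) a a (star a)) = norm a ^ 3"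

text \<open>The predual lives on a type \<open>'x\<close> of its own.  As \<open>'x\<close>, its scalar multiplication and \<open>T\<close> are
  universally quantified in any theorem about this locale, they amount to the hypothesis that some
  predual exists.  A unit exists
  automatically; \<open>type_I2\<close> below names it.\<close>

locale jbw_star_algebra = jb_star_algebra scaleC jprod star + predual: complex_banach scaleX
  for scaleC :: "complex \<Rightarrow> 'a::banach \<Rightarrow> 'a"
    and jprod :: "'a \<Rightarrow> 'a \<Rightarrow> 'a"
    and star :: "'a \<Rightarrow> 'a"
    and scaleX :: "complex \<Rightarrow> 'x::banach \<Rightarrow> 'x" +
  fixes T :: "'a \<Rightarrow> 'x \<Rightarrow>\<^sub>L complex"
  assumes dual_iso: "isometric_iso_onto_dual scaleC scaleX T"


section \<open>Projections, central covers, type $I_2$\<close>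

definition projections :: "('a \<Rightarrow> 'a \<Rightarrow> 'a) \<Rightarrow> ('a \<Rightarrow> 'a) \<Rightarrow> 'a set" where
  "projections m s = {p. s p = p \<and> m p p = p}"

definition centre :: "('a \<Rightarrow> 'a \<Rightarrow> 'a) \<Rightarrow> 'a set" where
  "centre m = {z. \<forall>b c. m (m z c) b = m z (m c b)}"

text \<open>For projections this agrees with the order of the self-adjoint part.\<close>

definition proj_le :: "('a \<Rightarrow> 'a \<Rightarrow> 'a) \<Rightarrow> 'a \<Rightarrow> 'a \<Rightarrow> bool" where
  "proj_le m p q \<longleftrightarrow> m p q = p"

definition is_central_cover ::
    "('a \<Rightarrow> 'a \<Rightarrow> 'a) \<Rightarrow> ('a \<Rightarrow> 'a) \<Rightarrow> 'a \<Rightarrow> 'a \<Rightarrow> bool" where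
  "is_central_cover m s p z \<longleftrightarrow>
     z \<in> projections m s \<inter> centre m \<and> proj_le m p z \<and>
     (\<forall>w \<in> projections m s \<inter> centre m. proj_le m p w \<longrightarrow> proj_le m z w)"

definition is_abelian ::
    "('a \<Rightarrow> 'a \<Rightarrow> 'a::ab_group_add) \<Rightarrow> 'a \<Rightarrow> bool" where
  "is_abelian m p \<longleftrightarrow>
     (\<forall>x \<in> range (jordan_U m p p). \<forall>y \<in> range (jordan_U m p p). \<forall>z \<in> range (jordan_U m p p).
        m (m x y) z = m x (m y z))"

definition is_unit :: "('a \<Rightarrow> 'a \<Rightarrow> 'a) \<Rightarrow> 'a \<Rightarrow> bool" where
  "is_unit m e \<longleftrightarrow> (\<forall>x. m e x = x \<and> m x e = x)"

definition type_I2 :: "('a \<Rightarrow> 'a \<Rightarrow> 'a::ab_group_add) \<Rightarrow> ('a \<Rightarrow> 'a) \<Rightarrow> bool" where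
  "type_I2 m s \<longleftrightarrow>
     (\<exists>e p1 p2. is_unit m e \<and>
        p1 \<in> projections m s \<and> p2 \<in> projections m s \<and> m p1 p2 = 0 \<and>
        is_abelian m p1 \<and> is_abelian m p2 \<and>
        is_central_cover m s p1 e \<and> is_central_cover m s p2 e \<and>
        p1 + p2 = e)"


section \<open>Measures on projections\<close>

text \<open>The map is total, but only the values of \<open>\<mu>\<close> on projections matter.\<close>

definition positive_fin_additive_measure ::
    "('a \<Rightarrow> 'a \<Rightarrow> 'a::ab_group_add) \<Rightarrow> ('a \<Rightarrow> 'a) \<Rightarrow> ('a \<Rightarrow> real) \<Rightarrow> bool" where
  "positive_fin_additive_measure m s \<mu> \<longleftrightarrow>
     (\<forall>p \<in> projections m s. 0 \<le> \<mu> p) \<and>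
     (\<forall>p \<in> projections m s. \<forall>q \<in> projections m s. m p q = 0 \<longrightarrow> \<mu> (p + q) = \<mu> p + \<mu> q)"

definition extends_to_bounded_functional ::
    "(complex \<Rightarrow> 'a::banach \<Rightarrow> 'a) \<Rightarrow> ('a \<Rightarrow> 'a \<Rightarrow> 'a) \<Rightarrow> ('a \<Rightarrow> 'a) \<Rightarrow> ('a \<Rightarrow> real) \<Rightarrow> bool" where
  "extends_to_bounded_functional scaleC m s \<mu> \<longleftrightarrow>
     (\<exists>\<phi>. bounded_complex_functional scaleC \<phi> \<and>
          (\<forall>p \<in> projections m s. \<phi> p = complex_of_real (\<mu> p)))"

end

(* Let p and e - p be the two abelian projections and let A be the self-adjoint part of the Peirce
   space of p for the eigenvalue 1, a commutative associative real algebra without nilpotents in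
   which p is the unit.  At a "point" of A, given here by a prime ideal M, the algebra looks like a
   spin factor, in which three orthogonal projections with sum e cannot all be non-zero:
   if a, b, c in A are the components of three such projections, then a b (c - c^2) = 0, so one of
   them lies in M.  Hence it is additive to assign to a projection q with component a the value 0 if
   a is in M, the value 1 if p - a is in M, and the value 1/2 otherwise.
   A non-zero self-adjoint w in the Peirce space of p for the eigenvalue 1/2 gives a norm-continuous
   path of projections from p to some q whose component is not p; choosing M not to contain the
   difference, the measure jumps along the path, which no continuous functional does.
   M comes from Zorn's lemma and need not be closed. *)

theory Submission
  imports Defs "HOL-Analysis.Lipschitz"
begin

section \<open>Jordan algebras and Peirce decompositions\<close>

lemma half_cancel:
  fixes a b z :: "'b::real_vector"
  assumes "a + (b + (1/2) *\<^sub>R z) = z + ((1/2) *\<^sub>R b + (1/2) *\<^sub>R a)"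
  shows "(1/2) *\<^sub>R z = (1/2) *\<^sub>R b + (1/2) *\<^sub>R a"
proof -
  have "2 *\<^sub>R (a + (b + (1/2) *\<^sub>R z)) = 2 *\<^sub>R (z + ((1/2) *\<^sub>R b + (1/2) *\<^sub>R a))"
    using assms by simp
  then have "z = a + b"
    by (simp add: scaleR_2 scaleR_right_distrib algebra_simps)
  then show ?thesis by (simp add: scaleR_right_distrib add.commute)
qed

lemma scaleR_3: "3 *\<^sub>R x = x + x + x" for x :: "'b::real_vector"
  using scaleR_left_distrib[of 1 2 x] by (simp add: scaleR_2)

locale jordan_algebra =
  fixes jprod :: "'a::real_vector \<Rightarrow> 'a \<Rightarrow> 'a"  (infixl \<open>\<odot>\<close> 70)
  assumes commute: "a \<odot> b = b \<odot> a"
    and add_left: "(a + b) \<odot> c = a \<odot> c + b \<odot> c"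
    and scaleR_left: "(r *\<^sub>R a) \<odot> b = r *\<^sub>R (a \<odot> b)"
    and jordan: "((a \<odot> a) \<odot> b) \<odot> a = (a \<odot> b) \<odot> (a \<odot> a)"
begin

lemma add_right: "c \<odot> (a + b) = c \<odot> a + c \<odot> b"
  by (metis add_left commute)

lemma scaleR_right: "a \<odot> (r *\<^sub>R b) = r *\<^sub>R (a \<odot> b)"
  by (metis scaleR_left commute)

lemma zero_left [simp]: "0 \<odot> a = 0"
  using scaleR_left[of 0 0 a] by simp

lemma zero_right [simp]: "a \<odot> 0 = 0"
  by (metis zero_left commute)

lemma minus_left [simp]: "(- a) \<odot> b = - (a \<odot> b)"
  using scaleR_left[of "-1" a b] by simp

lemma minus_right [simp]: "a \<odot> (- b) = - (a \<odot> b)"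
  using scaleR_right[of a "-1" b] by simp

lemma diff_left: "(a - b) \<odot> c = a \<odot> c - b \<odot> c"
  using add_left[of a "- b" c] by simp

lemma diff_right: "c \<odot> (a - b) = c \<odot> a - c \<odot> b"
  using add_right[of c a "- b"] by simp

lemmas bilinear = add_left add_right diff_left diff_right scaleR_left scaleR_right

text \<open>Full polarization of the Jordan identity, which is cubic in \<open>a\<close> for fixed
  \<open>b\<close>.\<close>

lemma linearized:
  "(x \<odot> y) \<odot> (z \<odot> t) + (y \<odot> z) \<odot> (x \<odot> t) + (z \<odot> x) \<odot> (y \<odot> t)
   = z \<odot> ((x \<odot> y) \<odot> t) + x \<odot> ((y \<odot> z) \<odot> t) + y \<odot> ((z \<odot> x) \<odot> t)"
proof -
  define N where "N x = (x \<odot> x) \<odot> (x \<odot> t) - x \<odot> ((x \<odot> x) \<odot> t)" for x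
  have N0: "N x = 0" for x
    using jordan[of x t] commute unfolding N_def by (metis right_minus_eq)
  let ?F = "(x \<odot> y) \<odot> (z \<odot> t) + (y \<odot> z) \<odot> (x \<odot> t) + (z \<odot> x) \<odot> (y \<odot> t)
   - (z \<odot> ((x \<odot> y) \<odot> t) + x \<odot> ((y \<odot> z) \<odot> t) + y \<odot> ((z \<odot> x) \<odot> t))"
  \<comment> \<open>Inclusion-exclusion isolates the trilinear part of the cubic map
    \<open>N\<close>. Its six permuted terms coincide in pairs by commutativity.\<close>
  have "N (x + y + z) - N (x + y) - N (y + z) - N (z + x) + N x + N y + N z = ?F + ?F"
    unfolding N_def by (simp add: bilinear algebra_simps commute)
  then have "?F + ?F = 0" by (simp add: N0)
  then have "2 *\<^sub>R ?F = 0" by (metis scaleR_2)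
  then show ?thesis by simp
qed

text \<open>The left-hand side of \<open>linearized\<close> is invariant under exchanging
  \<open>z\<close> and \<open>t\<close>, so its right-hand side is too.\<close>

lemma linearized_symmetric:
  "z \<odot> ((x \<odot> y) \<odot> t) + x \<odot> ((y \<odot> z) \<odot> t) + y \<odot> ((z \<odot> x) \<odot> t)
   = t \<odot> ((x \<odot> y) \<odot> z) + x \<odot> ((y \<odot> t) \<odot> z) + y \<odot> ((t \<odot> x) \<odot> z)"
  using linearized[of x y z t] linearized[of x y t z]
  by (simp add: commute algebra_simps)

lemma commutator_derivation:
  "x \<odot> (y \<odot> (z \<odot> t)) - y \<odot> (x \<odot> (z \<odot> t))
   = (x \<odot> (y \<odot> z) - y \<odot> (x \<odot> z)) \<odot> t + z \<odot> (x \<odot> (y \<odot> t) - y \<odot> (x \<odot> t))"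
  using linearized_symmetric[of x z t y] by (simp add: commute bilinear algebra_simps)

end

section \<open>Peirce spaces of an idempotent and their multiplication rules\<close>

locale peirce = jordan_algebra +
  fixes p
  assumes idem: "p \<odot> p = p"
begin

definition "P1 = {x. p \<odot> x = x}"
definition "Ph = {x. p \<odot> x = (1/2) *\<^sub>R x}"
definition "P0 = {x. p \<odot> x = 0}"

text \<open>Multiplication \<open>L\<close> by \<open>p\<close> is annihilated by
  \<open>L (2 L - 1) (L - 1)\<close>, so its only possible eigenvalues are 0, 1/2 and 1.\<close>

lemma operator_cubic: "2 *\<^sub>R (p \<odot> (p \<odot> (p \<odot> x))) = 3 *\<^sub>R (p \<odot> (p \<odot> x)) - p \<odot> x"
proof -
  have "p \<odot> (p \<odot> (p \<odot> x)) + p \<odot> (p \<odot> (p \<odot> x)) + p \<odot> x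
    = p \<odot> (p \<odot> x) + p \<odot> (p \<odot> x) + p \<odot> (p \<odot> x)"
    using linearized[of p p x p] by (simp add: idem commute algebra_simps)
  then show ?thesis
    by (simp add: scaleR_2 algebra_simps scaleR_left_distrib[of 1 2, simplified])
qed

lemma commutes_with_p:
  assumes "a \<in> P1 \<union> P0"
  shows "p \<odot> (a \<odot> x) = a \<odot> (p \<odot> x)"
  using linearized[of p p a x] assms by (auto simp: P1_def P0_def idem commute algebra_simps)

lemma P1_closed: "a \<in> P1 \<Longrightarrow> b \<in> P1 \<Longrightarrow> a \<odot> b \<in> P1"
  using commutes_with_p[of a b] by (auto simp: P1_def)

lemma P0_closed: "a \<in> P0 \<Longrightarrow> b \<in> P0 \<Longrightarrow> a \<odot> b \<in> P0"
  using commutes_with_p[of a b] by (auto simp: P0_def)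

lemma P1_Ph: "a \<in> P1 \<Longrightarrow> u \<in> Ph \<Longrightarrow> a \<odot> u \<in> Ph"
  using commutes_with_p[of a u] by (auto simp: P1_def Ph_def scaleR_right)

lemma P0_Ph: "a \<in> P0 \<Longrightarrow> u \<in> Ph \<Longrightarrow> a \<odot> u \<in> Ph"
  using commutes_with_p[of a u] by (auto simp: P0_def Ph_def scaleR_right)

text \<open>Moving \<open>p\<close> past \<open>a\<close> turns
  \<open>p \<odot> (a \<odot> b)\<close> into 0, and moving it past \<open>b\<close> turns it into
  \<open>a \<odot> b\<close>.\<close>

lemma P1_P0: "a \<in> P1 \<Longrightarrow> b \<in> P0 \<Longrightarrow> a \<odot> b = 0"
  using commutes_with_p[of a b] commutes_with_p[of b a]
  by (auto simp: P1_def P0_def commute)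

lemma Ph_Ph:
  assumes "u \<in> Ph" "v \<in> Ph"
  shows "p \<odot> (u \<odot> v) \<in> P1" "u \<odot> v - p \<odot> (u \<odot> v) \<in> P0"
proof -
  have "p \<odot> (p \<odot> (u \<odot> v)) = p \<odot> (u \<odot> v)"
    using linearized[of p u v p] assms
    by (simp add: Ph_def idem commute bilinear algebra_simps)
  then show "p \<odot> (u \<odot> v) \<in> P1" "u \<odot> v - p \<odot> (u \<odot> v) \<in> P0"
    by (auto simp: P1_def P0_def diff_right)
qed

lemma P1_P0_commute:
  assumes "a \<in> P1" "b \<in> P0"
  shows "a \<odot> (b \<odot> x) = b \<odot> (a \<odot> x)"
  using linearized[of a p b x] assms P1_P0[OF assms]
  by (simp add: P1_def P0_def commute algebra_simps)

text \<open>Equivalently, twice the multiplication by elements of \<open>P1\<close> is a Jordan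
  representation of \<open>P1\<close> on \<open>Ph\<close>.\<close>

lemma P1_jprod_on_Ph:
  assumes "a \<in> P1" "b \<in> P1" "u \<in> Ph"
  shows "(a \<odot> b) \<odot> u = a \<odot> (b \<odot> u) + b \<odot> (a \<odot> u)"
proof -
  have "p \<odot> (b \<odot> (a \<odot> u)) = (1/2) *\<^sub>R (b \<odot> (a \<odot> u))"
    using P1_Ph[OF assms(2) P1_Ph[OF assms(1,3)]] by (simp add: Ph_def)
  then have "a \<odot> (b \<odot> u) + (b \<odot> (a \<odot> u) + (1/2) *\<^sub>R ((a \<odot> b) \<odot> u)) =
      (a \<odot> b) \<odot> u + ((1/2) *\<^sub>R (b \<odot> (a \<odot> u)) + (1/2) *\<^sub>R (a \<odot> (b \<odot> u)))"
    using linearized[of a u p b] assms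
    by (simp add: P1_def Ph_def commute bilinear algebra_simps)
  from half_cancel[OF this]
  have "(1/2) *\<^sub>R ((a \<odot> b) \<odot> u) = (1/2) *\<^sub>R (a \<odot> (b \<odot> u) + b \<odot> (a \<odot> u))"
    by (simp add: scaleR_right_distrib add.commute)
  then show ?thesis by simp
qed

text \<open>This carries \<open>a \<odot> u = 0\<close> over to
  \<open>a \<odot> (u \<odot> u) = 0\<close>.\<close>

lemma Ph_form:
  assumes "a \<in> P1" "u \<in> Ph"
  shows "2 *\<^sub>R (p \<odot> ((a \<odot> u) \<odot> u)) = a \<odot> (u \<odot> u)"
proof -
  have "a \<odot> (u \<odot> u) = p \<odot> ((a \<odot> u) \<odot> u) + (1/2) *\<^sub>R (a \<odot> (u \<odot> u))"
    using linearized[of u a p u] assms scaleR_half_double[of "u \<odot> (a \<odot> u)"]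
    by (simp add: P1_def Ph_def commute bilinear algebra_simps)
  then have "2 *\<^sub>R (a \<odot> (u \<odot> u)) = 2 *\<^sub>R (p \<odot> ((a \<odot> u) \<odot> u) + (1/2) *\<^sub>R (a \<odot> (u \<odot> u)))"
    by simp
  then show ?thesis by (simp add: scaleR_2 scaleR_right_distrib)
qed

text \<open>The Jordan identity applied to \<open>p\<close>. It means that the two diagonal
  components of \<open>u \<odot> u\<close> act on \<open>u\<close> in the same way.\<close>

lemma Ph_cube:
  assumes "u \<in> Ph"
  shows "(p \<odot> (u \<odot> u)) \<odot> u = (1/2) *\<^sub>R (u \<odot> (u \<odot> u))"
  using jordan[of u p] assms by (simp add: Ph_def commute bilinear)

text \<open>The projections onto the Peirce spaces are the Lagrange interpolation polynomials in
  multiplication by \<open>p\<close> for the nodes 1, 1/2 and 0. Linearity and preservation of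
  \<open>S\<close> are then immediate.\<close>

definition "c1 x = 2 *\<^sub>R (p \<odot> (p \<odot> x)) - p \<odot> x"
definition "ch x = 4 *\<^sub>R (p \<odot> x - p \<odot> (p \<odot> x))"
definition "c0 x = x - 3 *\<^sub>R (p \<odot> x) + 2 *\<^sub>R (p \<odot> (p \<odot> x))"

lemma decomposition: "x = c1 x + ch x + c0 x"
proof -
  have "c1 x + ch x + c0 x = x + (2 - 4 + 2) *\<^sub>R (p \<odot> (p \<odot> x)) + (- 1 + 4 - 3) *\<^sub>R (p \<odot> x)"
    unfolding c1_def ch_def c0_def scaleR_left_distrib scaleR_left_diff_distrib
    by (simp add: scaleR_right_diff_distrib)
  then show ?thesis by simp
qed

lemma components: "c1 x \<in> P1" "ch x \<in> Ph" "c0 x \<in> P0"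
proof -
  define y z where "y = p \<odot> x" and "z = p \<odot> (p \<odot> x)"
  have z3: "p \<odot> z = (3/2) *\<^sub>R z - (1/2) *\<^sub>R y"
  proof -
    have "(1/2) *\<^sub>R (2 *\<^sub>R (p \<odot> z)) = (1/2) *\<^sub>R (3 *\<^sub>R z - y)"
      using operator_cubic[of x] by (simp add: y_def z_def)
    then show ?thesis by (simp add: scaleR_right_diff_distrib)
  qed
  have y2: "p \<odot> y = z" by (simp add: y_def z_def)
  have "p \<odot> (2 *\<^sub>R z - y) = 2 *\<^sub>R z - y"
    by (simp add: bilinear y2 z3 scaleR_right_diff_distrib flip: scaleR_left_diff_distrib)
      (simp add: algebra_simps scaleR_2 scaleR_3 flip: scaleR_left_diff_distrib scaleR_left_distrib)
  then show "c1 x \<in> P1" by (simp add: P1_def c1_def y_def z_def)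
  have "p \<odot> (4 *\<^sub>R (y - z)) = (1/2) *\<^sub>R (4 *\<^sub>R (y - z))"
    by (simp add: bilinear y2 z3 scaleR_right_diff_distrib flip: scaleR_left_diff_distrib)
  then show "ch x \<in> Ph" by (simp add: Ph_def ch_def y_def z_def)
  have "p \<odot> (x - 3 *\<^sub>R y + 2 *\<^sub>R z) = 0"
    by (simp add: bilinear y2 z3 scaleR_right_diff_distrib flip: y_def scaleR_left_diff_distrib)
  then show "c0 x \<in> P0" by (simp add: P0_def c0_def y_def z_def)
qed

lemma c1_linear: "c1 (x + y) = c1 x + c1 y" "c1 (x - y) = c1 x - c1 y"
  by (simp_all add: c1_def bilinear algebra_simps)

lemma ch_add: "ch (x + y) = ch x + ch y"
  by (simp add: ch_def bilinear algebra_simps)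

lemma component_eqI:
  assumes "a \<in> P1" "u \<in> Ph" "b \<in> P0"
  shows "c1 (a + u + b) = a" "ch (a + u + b) = u"
proof -
  have *: "p \<odot> (a + u + b) = a + (1/2) *\<^sub>R u" "p \<odot> (a + (1/2) *\<^sub>R u) = a + (1/4) *\<^sub>R u"
    using assms by (simp_all add: P1_def Ph_def P0_def bilinear)
  show "c1 (a + u + b) = a"
    unfolding c1_def * by (simp add: algebra_simps scaleR_2 flip: scaleR_left_distrib)
  show "ch (a + u + b) = u"
    unfolding ch_def * by (simp add: algebra_simps flip: scaleR_left_diff_distrib)
qed

lemma P1_Ph_P0_closed:
  "0 \<in> P1" "0 \<in> Ph" "0 \<in> P0"
  "x \<in> P1 \<Longrightarrow> y \<in> P1 \<Longrightarrow> x + y \<in> P1"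
  "x \<in> Ph \<Longrightarrow> y \<in> Ph \<Longrightarrow> x + y \<in> Ph"
  "x \<in> P0 \<Longrightarrow> y \<in> P0 \<Longrightarrow> x + y \<in> P0"
  "x \<in> P1 \<Longrightarrow> y \<in> P1 \<Longrightarrow> x - y \<in> P1"
  "x \<in> Ph \<Longrightarrow> y \<in> Ph \<Longrightarrow> x - y \<in> Ph"
  "x \<in> P0 \<Longrightarrow> y \<in> P0 \<Longrightarrow> x - y \<in> P0"
  "x \<in> P1 \<Longrightarrow> r *\<^sub>R x \<in> P1"
  "x \<in> Ph \<Longrightarrow> r *\<^sub>R x \<in> Ph"
  "x \<in> P0 \<Longrightarrow> r *\<^sub>R x \<in> P0"
  by (auto simp: P1_def Ph_def P0_def bilinear algebra_simps)

lemma component_jprod: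
  "c1 (x \<odot> y) = c1 x \<odot> c1 y + p \<odot> (ch x \<odot> ch y)" (is ?one)
  "ch (x \<odot> y) = c1 x \<odot> ch y + c1 y \<odot> ch x + c0 x \<odot> ch y + c0 y \<odot> ch x" (is ?half)
proof -
  let ?a = "c1 x \<odot> c1 y + p \<odot> (ch x \<odot> ch y)"
  let ?u = "c1 x \<odot> ch y + c1 y \<odot> ch x + c0 x \<odot> ch y + c0 y \<odot> ch x"
  let ?b = "c0 x \<odot> c0 y + (ch x \<odot> ch y - p \<odot> (ch x \<odot> ch y))"
  have "x \<odot> y = (c1 x + ch x + c0 x) \<odot> (c1 y + ch y + c0 y)"
    using decomposition by metis
  also have "\<dots> = ?a + ?u + ?b"
    using P1_P0[OF components(1,3), of x y] P1_P0[OF components(1,3), of y x]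
    by (simp add: bilinear commute algebra_simps)
  finally have *: "x \<odot> y = ?a + ?u + ?b" .
  have "?a \<in> P1" "?u \<in> Ph" "?b \<in> P0"
    by (intro P1_Ph_P0_closed P1_closed P0_closed P1_Ph P0_Ph Ph_Ph components)+
  from component_eqI[OF this] show ?one ?half unfolding * by auto
qed

text \<open>Multiplications by orthogonal idempotents commute, so
  \<open>q \<odot> (p \<odot> r) = r \<odot> (p \<odot> q)\<close>. The half components give
  \<open>?y + ?z = ?x + ?w\<close>, while those of \<open>q \<odot> r = 0\<close> make the sum of
  all four terms vanish.\<close>

lemma orthogonal_idempotents:
  assumes q: "q \<odot> q = q" and qr: "q \<odot> r = 0"
  shows "c1 q \<odot> ch r + c0 r \<odot> ch q = 0"
proof -
  interpret Q: peirce jprod q by unfold_locales (fact q)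
  have half: "c1 (p \<odot> x) = c1 x" "ch (p \<odot> x) = (1/2) *\<^sub>R ch x" "c0 (p \<odot> x) = 0" for x
  proof -
    have "p \<odot> x = c1 x + (1/2) *\<^sub>R ch x + 0"
      using components[of x] arg_cong[OF decomposition[of x], of "(\<odot>) p"]
      by (simp add: P1_def Ph_def P0_def add_right)
    then show h: "c1 (p \<odot> x) = c1 x" "ch (p \<odot> x) = (1/2) *\<^sub>R ch x"
      using component_eqI[of "c1 x" "(1/2) *\<^sub>R ch x" 0]
      by (simp_all only: components P1_Ph_P0_closed)
    show "c0 (p \<odot> x) = 0"
      using decomposition[of "p \<odot> x"] h \<open>p \<odot> x = c1 x + (1/2) *\<^sub>R ch x + 0\<close> by simp
  qed
  let ?x = "c1 q \<odot> ch r" and ?y = "c1 r \<odot> ch q" and ?z = "c0 q \<odot> ch r" and ?w = "c0 r \<odot> ch q"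
  have zero: "?x + ?y + ?z + ?w = 0"
    using component_jprod(2)[of q r] by (simp add: qr ch_def)
  have "q \<odot> (r \<odot> p) = r \<odot> (q \<odot> p)"
    using qr by (intro Q.commutes_with_p) (simp add: Q.P0_def)
  then have "ch (q \<odot> (p \<odot> r)) = ch (r \<odot> (p \<odot> q))"
    by (simp add: commute)
  then have "(1/2) *\<^sub>R ?x + ?y + (1/2) *\<^sub>R ?z = (1/2) *\<^sub>R ?y + ?x + (1/2) *\<^sub>R ?w"
    unfolding component_jprod(2)[of q "p \<odot> r"] component_jprod(2)[of r "p \<odot> q"]
    by (simp add: half bilinear)
  then have "2 *\<^sub>R ((1/2) *\<^sub>R ?x + ?y + (1/2) *\<^sub>R ?z) = 2 *\<^sub>R ((1/2) *\<^sub>R ?y + ?x + (1/2) *\<^sub>R ?w)"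
    by simp
  then have "?y + ?z = ?x + ?w"
    by (simp add: scaleR_2 scaleR_right_distrib algebra_simps)
  moreover have "?x + ?y + ?z + ?w = (?x + ?w) + (?y + ?z)"
    by (simp add: algebra_simps)
  ultimately have "(?x + ?w) + (?x + ?w) = 0" using zero by simp
  then show ?thesis by (metis scaleR_2 scaleR_eq_0_iff zero_neq_numeral)
qed

end

section \<open>Abelian idempotents\<close>

text \<open>\<open>S\<close> plays the role of the self-adjoint part.\<close>

locale abelian_peirce = peirce +
  fixes S :: "'a set"
  assumes S_subspace: "subspace S"
    and S_closed: "x \<in> S \<Longrightarrow> y \<in> S \<Longrightarrow> x \<odot> y \<in> S"
    and p_in_S: "p \<in> S"
    and reduced: "x \<in> S \<Longrightarrow> x \<odot> x = 0 \<Longrightarrow> x = 0"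
    and assoc: "a \<in> P1 \<inter> S \<Longrightarrow> b \<in> P1 \<inter> S \<Longrightarrow> c \<in> P1 \<inter> S \<Longrightarrow> (a \<odot> b) \<odot> c = a \<odot> (b \<odot> c)"
begin

lemmas S_add = subspace_add[OF S_subspace] and S_diff = subspace_diff[OF S_subspace]
  and S_scale = subspace_scale[OF S_subspace] and S_0 = subspace_0[OF S_subspace]

text \<open>The commutator \<open>D\<close> of the two multiplications is a derivation that vanishes on \<open>P1\<close> and \<open>P0\<close>.
  On \<open>Ph\<close> it commutes with multiplication by elements of \<open>P1\<close>; comparing it with the commutator for
  \<open>a \<odot> a\<close> gives \<open>D\<^sup>2 = 0\<close> there, and differentiating \<open>u \<odot> u\<close> twice shows \<open>(D u)\<^sup>2 = 0\<close>.\<close>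

lemma commute_on_Ph:
  assumes a: "a \<in> P1 \<inter> S" and b: "b \<in> P1 \<inter> S" and u: "u \<in> Ph \<inter> S"
  shows "a \<odot> (b \<odot> u) = b \<odot> (a \<odot> u)"
proof -
  define D where "D a x = a \<odot> (b \<odot> x) - b \<odot> (a \<odot> x)" for a x
  have D_add: "D a (x + y) = D a x + D a y" for a x y
    by (simp add: D_def bilinear)
  have D_jprod: "D a (x \<odot> y) = D a x \<odot> y + x \<odot> D a y" for a x y
    unfolding D_def by (rule commutator_derivation)
  have D_P1: "D a c = 0" if "a \<in> P1 \<inter> S" "c \<in> P1 \<inter> S" for a c
    using that assoc[of a b c] assoc[of b a c] b by (simp add: D_def commute)
  have D_P0: "D a c = 0" if "c \<in> P0" for c
    using P1_P0[of a c] P1_P0[of b c] a b that by (simp add: D_def)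
  have D_Ph: "D a v \<in> Ph \<inter> S" if "v \<in> Ph \<inter> S" for v
    using that a b by (auto simp: D_def intro!: P1_Ph P1_Ph_P0_closed S_closed S_diff)
  \<comment> \<open>On \<open>Ph\<close>, multiplication by \<open>a \<odot> a\<close> is twice the
    square of multiplication by \<open>a\<close>.\<close>
  have D_square: "D (a \<odot> a) v = 4 *\<^sub>R (a \<odot> D a v)" if v: "v \<in> Ph" for v
  proof -
    have "D (a \<odot> a) v = 2 *\<^sub>R (a \<odot> (a \<odot> (b \<odot> v))) - 2 *\<^sub>R (b \<odot> (a \<odot> (a \<odot> v)))"
      using P1_jprod_on_Ph[of a a v] P1_jprod_on_Ph[of a a "b \<odot> v"] P1_Ph[of b v] a b v
      by (simp add: D_def scaleR_2 bilinear)
    also have "\<dots> = 2 *\<^sub>R (a \<odot> D a v + D a (a \<odot> v))"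
      by (simp add: D_def bilinear algebra_simps)
    also have "D a (a \<odot> v) = a \<odot> D a v"
      using D_jprod[of a a v] D_P1[OF a a] by simp
    finally show ?thesis by (simp flip: scaleR_2)
  qed
  have D_D: "D a (D a v) = 0" if v: "v \<in> Ph \<inter> S" for v
  proof -
    have aa: "a \<odot> a \<in> P1 \<inter> S" using a by (auto intro: P1_closed S_closed)
    have "D (a \<odot> a) (b \<odot> v) = b \<odot> D (a \<odot> a) v"
      using D_jprod[of "a \<odot> a" b v] D_P1[OF aa b] by simp
    moreover have "D a (b \<odot> v) = b \<odot> D a v"
      using D_jprod[of a b v] D_P1[OF a b] by simp
    ultimately have "a \<odot> (b \<odot> D a v) = b \<odot> (a \<odot> D a v)"
      using D_square[of v] D_square[of "b \<odot> v"] P1_Ph[of b v] v b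
      by (simp add: bilinear)
    then show ?thesis by (simp add: D_def)
  qed
  \<comment> \<open>The two summands of \<open>u \<odot> u\<close> lie in \<open>P1\<close> and
    \<open>P0\<close>, where \<open>D a\<close> vanishes.\<close>
  have "D a (u \<odot> u) = D a (p \<odot> (u \<odot> u)) + D a (u \<odot> u - p \<odot> (u \<odot> u))"
    by (simp flip: D_add)
  also have "\<dots> = 0"
    using Ph_Ph[of u u] u p_in_S by (simp add: D_P1[OF a] D_P0 S_closed)
  finally have "D a u \<odot> u + D a u \<odot> u = 0"
    using D_jprod[of a u u] by (simp add: commute)
  then have "D a u \<odot> u = 0" by (metis scaleR_2 scaleR_eq_0_iff zero_neq_numeral)
  then have "D a (D a u \<odot> u) = 0" by (simp add: D_def)
  then have "D a u \<odot> D a u = 0"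
    using D_D[OF u] by (simp add: D_jprod)
  then have "D a u = 0" using D_Ph[OF u] reduced by auto
  then show ?thesis by (simp add: D_def)
qed

text \<open>By \<open>Ph_cube\<close> the cube of \<open>u\<close> vanishes, hence also its fourth
  power. Then \<open>reduced\<close> applies twice.\<close>

lemma Ph_square_zero:
  assumes "u \<in> Ph \<inter> S" "p \<odot> (u \<odot> u) = 0"
  shows "u = 0"
proof -
  have "u \<odot> (u \<odot> u) = 0"
    using Ph_cube[of u] assms by simp
  then have "(u \<odot> u) \<odot> (u \<odot> u) = 0"
    using jordan[of u u] by (simp add: commute)
  then show ?thesis using assms reduced S_closed by blast
qed

section \<open>Ideals of the diagonal algebra and existence of prime ideals\<close>

definition "A = P1 \<inter> S"

text \<open>Closure under real scalars and differences comes from multiplying by the elements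
  \<open>r *\<^sub>R p\<close> of \<open>A\<close>.\<close>

definition "is_ideal I \<longleftrightarrow> I \<subseteq> A \<and> 0 \<in> I \<and> (\<forall>x\<in>I. \<forall>y\<in>I. x + y \<in> I) \<and> (\<forall>a\<in>A. \<forall>x\<in>I. a \<odot> x \<in> I)"

definition "is_prime I \<longleftrightarrow> is_ideal I \<and> p \<notin> I \<and> (\<forall>x\<in>A. \<forall>y\<in>A. x \<odot> y \<in> I \<longrightarrow> x \<in> I \<or> y \<in> I)"

lemma A_closed:
  "0 \<in> A" "p \<in> A"
  "x \<in> A \<Longrightarrow> y \<in> A \<Longrightarrow> x + y \<in> A" "x \<in> A \<Longrightarrow> y \<in> A \<Longrightarrow> x - y \<in> A"
  "x \<in> A \<Longrightarrow> y \<in> A \<Longrightarrow> x \<odot> y \<in> A" "x \<in> A \<Longrightarrow> r *\<^sub>R x \<in> A"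
  by (auto simp: A_def p_in_S S_0 idem intro!: P1_Ph_P0_closed S_add S_diff S_scale P1_closed S_closed)
    (simp add: P1_def idem)

lemma A_assoc: "x \<in> A \<Longrightarrow> y \<in> A \<Longrightarrow> z \<in> A \<Longrightarrow> (x \<odot> y) \<odot> z = x \<odot> (y \<odot> z)"
  by (simp add: A_def assoc)

lemma A_unit: "x \<in> A \<Longrightarrow> p \<odot> x = x" "x \<in> A \<Longrightarrow> x \<odot> p = x"
  by (simp_all add: A_def P1_def commute)

lemma ideal_closed:
  assumes "is_ideal I"
  shows "x \<in> I \<Longrightarrow> y \<in> I \<Longrightarrow> x + y \<in> I" "x \<in> I \<Longrightarrow> r *\<^sub>R x \<in> I" "x \<in> I \<Longrightarrow> y \<in> I \<Longrightarrow> x - y \<in> I"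
    "x \<in> I \<Longrightarrow> a \<in> A \<Longrightarrow> a \<odot> x \<in> I" "x \<in> I \<Longrightarrow> a \<in> A \<Longrightarrow> x \<odot> a \<in> I" "x \<in> I \<Longrightarrow> x \<in> A"
proof -
  show add: "x \<in> I \<Longrightarrow> y \<in> I \<Longrightarrow> x + y \<in> I" and "x \<in> I \<Longrightarrow> a \<in> A \<Longrightarrow> a \<odot> x \<in> I"
    and "x \<in> I \<Longrightarrow> a \<in> A \<Longrightarrow> x \<odot> a \<in> I" and "x \<in> I \<Longrightarrow> x \<in> A" for x y a
    using assms by (auto simp: is_ideal_def commute)
  show scale: "x \<in> I \<Longrightarrow> r *\<^sub>R x \<in> I" for x r
  proof -
    assume x: "x \<in> I"
    then have "(r *\<^sub>R p) \<odot> x \<in> I"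
      using assms A_closed by (auto simp: is_ideal_def)
    then show ?thesis
      using x assms A_unit by (auto simp: scaleR_left is_ideal_def)
  qed
  show "x \<in> I \<Longrightarrow> y \<in> I \<Longrightarrow> x - y \<in> I"
    using add[of x "(-1) *\<^sub>R y"] scale[of y "-1"] by simp
qed

text \<open>An ideal that is maximal among those containing no power of \<open>d\<close> is prime.
  Such ideals exist because no power of \<open>d\<close> is 0 in a reduced algebra.\<close>

lemma prime_ideal_avoiding:
  assumes d: "d \<in> A" "d \<noteq> 0"
  obtains M where "is_prime M" "d \<notin> M"
proof -
  \<comment> \<open>The powers start at \<open>pw 0 = p\<close>, so avoiding all of them makes an
    ideal proper.\<close>
  define pw where "pw n = (((\<odot>) d) ^^ n) p" for n
  have pw_A: "pw n \<in> A" for n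
    by (induction n) (auto simp: pw_def A_closed d)
  have pw_add: "pw (m + n) = pw m \<odot> pw n" for m n
  proof (induction m)
    case 0
    show ?case using A_unit[OF pw_A[of n]] by (simp add: pw_def)
  next
    case (Suc m)
    then show ?case
      using A_assoc[OF d(1) pw_A[of m] pw_A[of n]] by (simp add: pw_def)
  qed
  have pw_1: "pw 1 = d" using d by (simp add: pw_def A_unit)
  \<comment> \<open>\<open>reduced\<close> controls squares only, so exponents double first. Every
    other power divides one of these.\<close>
  have "pw (2 ^ k) \<noteq> 0" for k
  proof (induction k)
    case 0
    then show ?case using d pw_1 by simp
  next
    case (Suc k)
    then show ?case
      using reduced[of "pw (2 ^ k)"] pw_A[of "2 ^ k"]
      by (auto simp: mult_2 pw_add A_def)
  qed
  then have pw_nz: "pw n \<noteq> 0" for n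
    using pw_add[of n "2 ^ n - n"] less_exp[of n]
    by (metis le_add_diff_inverse less_imp_le zero_left)
  define F where "F = {I. is_ideal I \<and> (\<forall>n. pw n \<notin> I)}"
  have "{0} \<in> F"
    using pw_nz by (auto simp: F_def is_ideal_def A_closed)
  then have "F \<noteq> {}" by blast
  moreover have "\<Union>C \<in> F" if C: "C \<noteq> {}" "subset.chain F C" for C
  proof -
    have CF: "\<And>I. I \<in> C \<Longrightarrow> I \<in> F" and total: "\<And>I J. I \<in> C \<Longrightarrow> J \<in> C \<Longrightarrow> I \<subseteq> J \<or> J \<subseteq> I"
      using C by (auto simp: subset.chain_def subset_chain_def)
    have id: "is_ideal I" if "I \<in> C" for I using CF[OF that] by (simp add: F_def)
    have "x + y \<in> \<Union>C" if xy: "x \<in> \<Union>C" "y \<in> \<Union>C" for x y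
    proof -
      from xy obtain I J where "I \<in> C" "J \<in> C" "x \<in> I" "y \<in> J" by blast
      then show ?thesis
        using total[of I J] ideal_closed(1)[OF id, of I x y] ideal_closed(1)[OF id, of J x y] by blast
    qed
    moreover have "0 \<in> \<Union>C" using C(1) id by (auto simp: is_ideal_def)
    ultimately have "is_ideal (\<Union>C)"
      using id unfolding is_ideal_def by blast
    then show ?thesis using CF by (auto simp: F_def)
  qed
  ultimately obtain M where M: "M \<in> F" and max: "\<And>I. I \<in> F \<Longrightarrow> M \<subseteq> I \<Longrightarrow> I = M"
    using subset_Zorn_nonempty[of F] by metis
  have M_ideal: "is_ideal M" and M_pw: "pw n \<notin> M" for n using M by (auto simp: F_def)
  note M_closed = ideal_closed[OF M_ideal]
  \<comment> \<open>By maximality, the ideal generated by \<open>M\<close> and \<open>x\<close>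
    meets the powers of \<open>d\<close>.\<close>
  have power_in: "\<exists>n i a. i \<in> M \<and> a \<in> A \<and> pw n = i + a \<odot> x" if x: "x \<in> A" "x \<notin> M" for x
  proof (rule ccontr)
    assume no: "\<not> ?thesis"
    define I where "I = {i + a \<odot> x | i a. i \<in> M \<and> a \<in> A}"
    have "is_ideal I"
      unfolding is_ideal_def
    proof (intro conjI ballI)
      show "I \<subseteq> A" using x M_closed(6) by (auto simp: I_def intro!: A_closed(3,5))
      show "0 \<in> I"
        using A_closed(1) M_ideal unfolding I_def is_ideal_def
        by (force intro!: exI[of _ 0])
    next
      fix y z assume "y \<in> I" "z \<in> I"
      then obtain i a j b where "y = i + a \<odot> x" "z = j + b \<odot> x" "i \<in> M" "a \<in> A" "j \<in> M" "b \<in> A"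
        by (auto simp: I_def)
      moreover from this have "y + z = (i + j) + (a + b) \<odot> x" by (simp add: add_left)
      ultimately show "y + z \<in> I" unfolding I_def using M_closed(1) A_closed(3) by blast
    next
      fix b y assume b: "b \<in> A" and "y \<in> I"
      then obtain i a where "y = i + a \<odot> x" "i \<in> M" "a \<in> A"
        by (auto simp: I_def)
      moreover from this b have "b \<odot> y = b \<odot> i + (b \<odot> a) \<odot> x"
        using x by (simp add: add_right A_assoc)
      ultimately show "b \<odot> y \<in> I" unfolding I_def using M_closed(4) A_closed(5) b by blast
    qed
    moreover have "pw n \<notin> I" for n using no by (auto simp: I_def)
    ultimately have "I \<in> F" by (simp add: F_def)
    moreover have "M \<subseteq> I"
      using A_closed(1) unfolding I_def by (force intro: exI[of _ 0])
    moreover have "x \<in> I"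
      using A_closed(2) A_unit(1)[OF x(1)] M_ideal unfolding I_def is_ideal_def
      by (force intro: exI[of _ 0] exI[of _ p])
    ultimately show False using max x(2) by blast
  qed
  have "x \<in> M \<or> y \<in> M" if xy: "x \<in> A" "y \<in> A" "x \<odot> y \<in> M" for x y
  proof (rule ccontr)
    assume "\<not> ?thesis"
    then obtain m i a n j b where i: "i \<in> M" "a \<in> A" "pw m = i + a \<odot> x"
      and j: "j \<in> M" "b \<in> A" "pw n = j + b \<odot> y"
      using power_in[OF xy(1)] power_in[OF xy(2)] by metis
    have "(a \<odot> x) \<odot> (b \<odot> y) = (a \<odot> b) \<odot> (x \<odot> y)"
    proof -
      have "(a \<odot> x) \<odot> (b \<odot> y) = a \<odot> ((x \<odot> b) \<odot> y)"
        using i j xy by (simp add: A_assoc A_closed)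
      also have "\<dots> = a \<odot> ((b \<odot> x) \<odot> y)" by (simp add: commute)
      also have "\<dots> = (a \<odot> b) \<odot> (x \<odot> y)"
        using i j xy by (simp add: A_assoc A_closed)
      finally show ?thesis .
    qed
    then have "pw (m + n) = i \<odot> pw n + ((a \<odot> x) \<odot> j + (a \<odot> b) \<odot> (x \<odot> y))"
      unfolding pw_add i(3) by (simp add: add_left j(3) add_right)
    also have "\<dots> \<in> M"
      by (intro M_closed(1) M_closed(5)[OF i(1) pw_A] M_closed(4)[OF j(1)] M_closed(4)[OF xy(3)]
          A_closed(5) i(2) j(2) xy(1,2))
    finally show False using M_pw by blast
  qed
  moreover have "p \<notin> M" using M_pw[of 0] by (simp add: pw_def)
  moreover have "d \<notin> M" using M_pw[of 1] pw_1 by simp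
  ultimately show ?thesis using that[of M] M_ideal by (simp add: is_prime_def)
qed

end

section \<open>Measures from prime ideals\<close>

locale abelian_frame = abelian_peirce +
  fixes e
  assumes unit: "e \<odot> x = x"
    and e_in_S: "e \<in> S"
    and assoc0: "a \<in> P0 \<inter> S \<Longrightarrow> b \<in> P0 \<inter> S \<Longrightarrow> c \<in> P0 \<inter> S \<Longrightarrow> (a \<odot> b) \<odot> c = a \<odot> (b \<odot> c)"
begin

sublocale compl: peirce jprod "e - p"
  by unfold_locales (simp add: bilinear unit idem commute[of p e])

lemma compl_P1: "compl.P1 = P0"
  by (auto simp: compl.P1_def P0_def diff_left unit)

lemma compl_Ph: "compl.Ph = Ph"
proof -
  have "x - y = (1/2) *\<^sub>R x \<longleftrightarrow> y = (1/2) *\<^sub>R x" for x y :: 'a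
  proof -
    have "(1 - 1/2) *\<^sub>R x = x - (1/2) *\<^sub>R x"
      by (simp only: scaleR_left_diff_distrib scaleR_one)
    then have half: "x - (1/2) *\<^sub>R x = (1/2) *\<^sub>R x" by simp
    have "x - y = z \<longleftrightarrow> y = x - z" for z by (auto simp: algebra_simps)
    from this[of "(1/2) *\<^sub>R x"] show ?thesis unfolding half .
  qed
  then show ?thesis by (simp only: compl.Ph_def Ph_def diff_left unit)
qed

text \<open>With \<open>P1\<close> and \<open>P0\<close> exchanged, \<open>commute_on_Ph\<close>
  becomes available for multiplications by elements of \<open>P0\<close>.\<close>

sublocale compl: abelian_peirce jprod "e - p" S
proof
  show "e - p \<in> S" by (intro S_diff e_in_S p_in_S)
qed (fact S_subspace S_closed reduced assoc0[folded compl_P1])+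

lemma components_in_S:
  assumes "x \<in> S" shows "c1 x \<in> S" "ch x \<in> S" "c0 x \<in> S"
  using assms p_in_S unfolding c1_def ch_def c0_def
  by (auto intro!: S_add S_diff S_scale S_closed)

lemma c1_unit: "c1 e = p"
  by (simp add: c1_def commute[of p e] unit idem scaleR_2)

lemma ch_unit: "ch e = 0"
  by (simp add: ch_def commute[of p e] unit idem scaleR_2)

text \<open>By \<open>orthogonal_idempotents\<close>, multiplication of \<open>ch x\<close> by \<open>c0 y\<close> is minus multiplication of \<open>ch y\<close> by \<open>c1 x\<close>.
  Thus the commutation of the \<open>c0\<close> components shows that \<open>w\<close> below is symmetric in \<open>q\<close>, \<open>r\<close>, \<open>s\<close>; since
  \<open>ch q + ch r + ch s = 0\<close>, it follows that \<open>p \<odot> w = 0\<close>, hence \<open>w = 0\<close>.\<close>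

lemma product_of_three:
  assumes S: "q \<in> S" "r \<in> S" "s \<in> S"
    and idems: "q \<odot> q = q" "r \<odot> r = r" "s \<odot> s = s"
    and orth: "q \<odot> r = 0" "q \<odot> s = 0" "r \<odot> s = 0"
    and sum: "q + r + s = e"
  shows "(c1 q \<odot> c1 r) \<odot> (c1 s - c1 s \<odot> c1 s) = 0"
proof -
  note in_S = S[THEN components_in_S(1)] S[THEN components_in_S(2)] S[THEN components_in_S(3)]
  have orth': "r \<odot> q = 0" "s \<odot> q = 0" "s \<odot> r = 0" using orth commute by metis+
  have swap: "c0 y \<odot> ch x = - (c1 x \<odot> ch y)" if "x \<odot> x = x" "x \<odot> y = 0" for x y
    using orthogonal_idempotents[OF that] by (simp add: add_eq_0_iff)
  have comm1: "c1 x \<odot> (c1 y \<odot> ch z) = c1 y \<odot> (c1 x \<odot> ch z)" if "x \<in> S" "y \<in> S" "z \<in> S" for x y z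
    using that by (intro commute_on_Ph) (auto simp: components components_in_S)
  have comm0: "c0 x \<odot> (c0 y \<odot> ch z) = c0 y \<odot> (c0 x \<odot> ch z)" if "x \<in> S" "y \<in> S" "z \<in> S" for x y z
    using that by (intro compl.commute_on_Ph) (auto simp: components components_in_S compl_P1 compl_Ph)
  have comm10: "c1 x \<odot> (c0 y \<odot> z) = c0 y \<odot> (c1 x \<odot> z)" for x y z
    by (intro P1_P0_commute components)
  have perm: "c1 x \<odot> (c1 y \<odot> ch z) = c1 x \<odot> (c1 z \<odot> ch y)"
    if "x \<in> S" "y \<in> S" "z \<in> S" "x \<odot> x = x" "y \<odot> y = y" "z \<odot> z = z"
      "x \<odot> y = 0" "y \<odot> z = 0" "x \<odot> z = 0" "z \<odot> y = 0" for x y z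
  proof -
    have "c0 z \<odot> (c0 y \<odot> ch x) = c1 x \<odot> (c1 y \<odot> ch z)"
      using that by (simp add: swap flip: comm10)
    moreover have "c0 y \<odot> (c0 z \<odot> ch x) = c1 x \<odot> (c1 z \<odot> ch y)"
      using that by (simp add: swap flip: comm10)
    ultimately show ?thesis using comm0[of z y x] that by simp
  qed
  define w where "w = c1 q \<odot> (c1 r \<odot> ch s)"
  have w: "w = c1 q \<odot> (c1 s \<odot> ch r)" "w = c1 r \<odot> (c1 s \<odot> ch q)"
    using perm[of q r s] perm[of r q s] comm1[of q r s] S idems orth orth'
    by (simp_all add: w_def)
  have "c1 q \<odot> w + c1 r \<odot> w + c1 s \<odot> w
    = c1 q \<odot> (c1 r \<odot> (c1 s \<odot> (ch q + ch r + ch s)))"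
  proof -
    have Ph: "ch x \<in> Ph \<inter> S" "c1 y \<odot> ch x \<in> Ph \<inter> S" if "x \<in> S" "y \<in> S" for x y
      using that by (auto simp: components components_in_S intro!: P1_Ph S_closed)
    have P1: "c1 x \<in> P1 \<inter> S" if "x \<in> S" for x
      using that by (auto simp: components components_in_S)
    have "c1 q \<odot> w = c1 q \<odot> (c1 r \<odot> (c1 s \<odot> ch q))" by (simp add: w(2))
    moreover have "c1 r \<odot> w = c1 q \<odot> (c1 r \<odot> (c1 s \<odot> ch r))"
      unfolding w(1) using commute_on_Ph[OF P1 P1 Ph(2)] S by blast
    moreover have "c1 s \<odot> w = c1 q \<odot> (c1 r \<odot> (c1 s \<odot> ch s))"
      unfolding w_def using commute_on_Ph[OF P1 P1 Ph(2)] commute_on_Ph[OF P1 P1 Ph(1)] S by metis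
    ultimately show ?thesis by (simp add: add_right)
  qed
  also have "ch q + ch r + ch s = 0"
    using sum ch_unit by (simp flip: ch_add)
  finally have "(c1 q + c1 r + c1 s) \<odot> w = 0" by (simp add: add_left)
  moreover have "c1 q + c1 r + c1 s = p"
    using sum c1_unit by (simp flip: c1_linear)
  moreover have "w \<in> Ph"
    unfolding w_def by (intro P1_Ph components)
  ultimately have w0: "w = 0" by (simp add: Ph_def)
  have P1: "c1 q \<odot> c1 r \<in> P1" by (intro P1_closed components)
  \<comment> \<open>This product is \<open>2 *\<^sub>R w\<close>, as the two multiplications commute
    on \<open>ch s\<close>. Next, \<open>Ph_form\<close> passes from \<open>ch s\<close> to its
    square, whose \<open>P1\<close> component is \<open>c1 s - c1 s \<odot> c1 s\<close>.\<close>
  have "(c1 q \<odot> c1 r) \<odot> ch s = 0"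
    using P1_jprod_on_Ph[of "c1 q" "c1 r" "ch s"] w0 comm1[of q r s] S
    by (simp add: components w_def)
  then have "(c1 q \<odot> c1 r) \<odot> (ch s \<odot> ch s) = 0"
    using Ph_form[OF P1, of "ch s"] components by simp
  then have "(c1 q \<odot> c1 r) \<odot> (p \<odot> (ch s \<odot> ch s)) = 0"
    using commutes_with_p[of "c1 q \<odot> c1 r" "ch s \<odot> ch s"] P1 by simp
  moreover have "c1 s - c1 s \<odot> c1 s = p \<odot> (ch s \<odot> ch s)"
    using component_jprod(1)[of s s] idems(3) by (metis add_diff_cancel_left')
  ultimately show ?thesis by simp
qed

lemma c1_in_A: "x \<in> S \<Longrightarrow> c1 x \<in> A"
  by (simp add: A_def components components_in_S)

text \<open>If none lay in \<open>M\<close>, primeness and \<open>product_of_three\<close> would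
  make each component congruent to \<open>p\<close>. The components add up to \<open>p\<close>, so
  \<open>2 *\<^sub>R p\<close> would lie in \<open>M\<close>.\<close>

lemma prime_contains_component:
  assumes M: "is_prime M"
    and S: "q \<in> S" "r \<in> S" "s \<in> S"
    and idems: "q \<odot> q = q" "r \<odot> r = r" "s \<odot> s = s"
    and orth: "q \<odot> r = 0" "q \<odot> s = 0" "r \<odot> s = 0"
    and sum: "q + r + s = e"
  shows "c1 q \<in> M \<or> c1 r \<in> M \<or> c1 s \<in> M"
proof (rule ccontr)
  assume no: "\<not> ?thesis"
  have M_ideal: "is_ideal M" and prime: "\<And>x y. x \<in> A \<Longrightarrow> y \<in> A \<Longrightarrow> x \<odot> y \<in> M \<Longrightarrow> x \<in> M \<or> y \<in> M"
    and pM: "p \<notin> M"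
    using M by (auto simp: is_prime_def)
  have one: "p - c1 z \<in> M" if "x \<in> S" "y \<in> S" "z \<in> S" "c1 x \<notin> M" "c1 y \<notin> M" "c1 z \<notin> M"
      "(c1 x \<odot> c1 y) \<odot> (c1 z - c1 z \<odot> c1 z) = 0" for x y z
  proof -
    have "(c1 x \<odot> c1 y) \<odot> (c1 z \<odot> (p - c1 z)) \<in> M"
      using that A_unit[OF c1_in_A[OF that(3)]] M_ideal by (simp add: diff_right is_ideal_def)
    then show ?thesis
      using prime[of "c1 x \<odot> c1 y" "c1 z \<odot> (p - c1 z)"] prime[of "c1 x" "c1 y"]
        prime[of "c1 z" "p - c1 z"] that by (auto simp: A_closed c1_in_A)
  qed
  have orth': "r \<odot> q = 0" "s \<odot> q = 0" "s \<odot> r = 0" using orth commute by metis+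
  have "p - c1 s \<in> M"
    using no by (intro one[OF S(1,2,3)] product_of_three S idems orth orth' sum) auto
  moreover have "p - c1 r \<in> M"
    using no sum by (intro one[OF S(1,3,2)] product_of_three S idems orth orth') (auto simp: algebra_simps)
  moreover have "p - c1 q \<in> M"
    using no sum by (intro one[OF S(2,3,1)] product_of_three S idems orth orth') (auto simp: algebra_simps)
  ultimately have "(1/2) *\<^sub>R ((p - c1 q) + (p - c1 r) + (p - c1 s)) \<in> M"
    by (intro ideal_closed(1,2)[OF M_ideal])
  moreover have "c1 q + c1 r + c1 s = p"
    using sum c1_unit by (simp flip: c1_linear)
  then have "(p - c1 q) + (p - c1 r) + (p - c1 s) = p + p"
    by (simp add: algebra_simps)
  ultimately show False using pM by simp
qed

section \<open>The three-valued measure of a prime ideal\<close>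

definition prime_measure :: "'a set \<Rightarrow> 'a \<Rightarrow> real" where
  "prime_measure M q = (if c1 q \<in> M then 0 else if p - c1 q \<in> M then 1 else 1/2)"

lemma prime_measure_add:
  assumes M: "is_prime M"
    and S: "q \<in> S" "r \<in> S"
    and idems: "q \<odot> q = q" "r \<odot> r = r" and orth: "q \<odot> r = 0"
  shows "prime_measure M (q + r) = prime_measure M q + prime_measure M r"
proof -
  \<comment> \<open>Completing \<open>q\<close> and \<open>r\<close> to three projections with sum
    \<open>e\<close> puts one of three components into \<open>M\<close>.\<close>
  define s where "s = e - q - r"
  have M_ideal: "is_ideal M" and pM: "p \<notin> M"
    using M by (auto simp: is_prime_def)
  note M_closed = ideal_closed[OF M_ideal]
  have unit': "x \<odot> e = x" for x using unit commute by metis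
  have orth': "r \<odot> q = 0" using orth commute by metis
  have "c1 q \<in> M \<or> c1 r \<in> M \<or> c1 s \<in> M"
    using S e_in_S orth orth'
    by (intro prime_contains_component[OF M] idems)
      (auto simp: s_def bilinear unit unit' idems intro!: S_diff)
  moreover have c1s: "c1 s = p - (c1 q + c1 r)"
    by (simp add: s_def c1_linear c1_unit)
  ultimately consider "c1 q \<in> M" | "c1 r \<in> M" | "p - (c1 q + c1 r) \<in> M" by auto
  then show ?thesis
  proof cases
    case 1
    then have "c1 r + c1 q \<in> M \<longleftrightarrow> c1 r \<in> M" "p - (c1 r + c1 q) \<in> M \<longleftrightarrow> p - c1 r \<in> M"
      using M_closed(1)[of "c1 r" "c1 q"] M_closed(3)[of "c1 r + c1 q" "c1 q"]
        M_closed(3)[of "p - c1 r" "c1 q"] M_closed(1)[of "p - (c1 r + c1 q)" "c1 q"]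
      by (auto simp: algebra_simps)
    then show ?thesis using 1 by (simp add: prime_measure_def c1_linear add.commute)
  next
    case 2
    then have "c1 q + c1 r \<in> M \<longleftrightarrow> c1 q \<in> M" "p - (c1 q + c1 r) \<in> M \<longleftrightarrow> p - c1 q \<in> M"
      using M_closed(1)[of "c1 q" "c1 r"] M_closed(3)[of "c1 q + c1 r" "c1 r"]
        M_closed(3)[of "p - c1 q" "c1 r"] M_closed(1)[of "p - (c1 q + c1 r)" "c1 r"]
      by (auto simp: algebra_simps)
    then show ?thesis using 2 by (simp add: prime_measure_def c1_linear)
  next
    case 3
    \<comment> \<open>Here \<open>q + r\<close> has value 1. Modulo \<open>M\<close>,
      \<open>c1 q\<close> and \<open>c1 r\<close> are complementary, so their values are 0 and 1 in
      some order or both 1/2.\<close>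
    have "c1 q + c1 r \<notin> M"
      using M_closed(1)[OF 3, of "c1 q + c1 r"] pM by auto
    moreover have "p - c1 r \<in> M \<longleftrightarrow> c1 q \<in> M"
      using M_closed(1)[OF 3, of "c1 q"] M_closed(3)[OF _ 3, of "p - c1 r"] by (auto simp: algebra_simps)
    moreover have "p - c1 q \<in> M \<longleftrightarrow> c1 r \<in> M"
      using M_closed(1)[OF 3, of "c1 r"] M_closed(3)[OF _ 3, of "p - c1 q"] by (auto simp: algebra_simps)
    ultimately show ?thesis using 3 M_closed(1)[of "c1 q" "c1 r"]
      by (auto simp: prime_measure_def c1_linear)
  qed
qed

end

section \<open>Norm-continuous paths of projections\<close>

locale banach_frame = abelian_frame jprod p S e
  for jprod :: "'a::banach \<Rightarrow> 'a \<Rightarrow> 'a"  (infixl \<open>\<odot>\<close> 70) and p S e +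
  assumes norm_jprod: "norm (a \<odot> b) \<le> norm a * norm b"
    and S_complete: "closed S"
begin

sublocale bounded: bounded_bilinear "(\<odot>)"
proof
  show "\<exists>K. \<forall>a b. norm (a \<odot> b) \<le> norm a * norm b * K"
    by (rule exI[of _ 1]) (simp add: norm_jprod)
qed (simp_all only: bilinear)

text \<open>The path is \<open>q = (e + s) / 2\<close> for the symmetries \<open>s = (2 p - e) \<odot> (e - y) + t w\<close>, where
  \<open>e - y\<close> is the square root of \<open>e - t\<^sup>2 w\<^sup>2\<close> and \<open>y\<close> is found as the fixed point of
  \<open>y = (t\<^sup>2 w\<^sup>2 + y\<^sup>2) / 2\<close>.  The set \<open>W\<close> below consists of elements whose two diagonal components
  act on \<open>w\<close> in the same way, which makes the cross terms of \<open>s \<odot> s\<close> cancel.\<close>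

lemma projection_path:
  assumes w: "w \<in> Ph \<inter> S" "norm (w \<odot> w) \<le> 1/2"
  shows "\<exists>q. continuous_on {0..1::real} q \<and> q 0 = p \<and> (\<forall>t\<in>{0..1}. q t \<in> S \<and> q t \<odot> q t = q t) \<and>
    ch (q 1) = (1/2) *\<^sub>R w"
proof -
  define W where "W = {y \<in> S. p \<odot> (p \<odot> y) = p \<odot> y \<and> 2 *\<^sub>R ((p \<odot> y) \<odot> w) = y \<odot> w}"
  have W_scale: "r *\<^sub>R y \<in> W" if "y \<in> W" for r y
  proof -
    have "2 *\<^sub>R ((p \<odot> (r *\<^sub>R y)) \<odot> w) = r *\<^sub>R (2 *\<^sub>R ((p \<odot> y) \<odot> w))"
      by (simp add: bilinear)
    also have "\<dots> = (r *\<^sub>R y) \<odot> w"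
      using that by (simp add: W_def scaleR_left del: scaleR_scaleR)
    finally show ?thesis using that by (simp add: W_def S_scale bilinear)
  qed
  have W_add: "y + z \<in> W" if "y \<in> W" "z \<in> W" for y z
    using that by (simp add: W_def bilinear S_add scaleR_right_distrib)
  have W_parts: "p \<odot> y \<in> P1" "y - p \<odot> y \<in> P0" if "y \<in> W" for y
    using that by (auto simp: W_def P1_def P0_def diff_right)
  have W_square: "y \<odot> y \<in> W" if y: "y \<in> W" for y
  proof -
    define a b where "a = p \<odot> y" and "b = y - p \<odot> y"
    have ab: "a \<in> P1" "b \<in> P0" "a \<odot> w = b \<odot> w" "y = a + b"
      using W_parts[OF y] y by (auto simp: a_def b_def W_def diff_left scaleR_2 algebra_simps)
    have ba: "b \<odot> a = 0" using P1_P0[OF ab(1,2)] by (simp add: commute)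
    have "y \<odot> y = a \<odot> a + b \<odot> b"
      using P1_P0[OF ab(1,2)] ba by (simp add: ab(4) bilinear)
    moreover have "p \<odot> (a \<odot> a) = a \<odot> a" "p \<odot> (b \<odot> b) = 0"
      using P1_closed[OF ab(1,1)] P0_closed[OF ab(2,2)] by (simp_all add: P1_def P0_def)
    moreover have "(a \<odot> a) \<odot> w = (b \<odot> b) \<odot> w"
      using P1_jprod_on_Ph[of a a w] compl.P1_jprod_on_Ph[of b b w] P1_P0_commute[OF ab(1,2), of w]
        ab w by (simp add: compl_P1 compl_Ph)
    ultimately show ?thesis
      using y S_closed[of y y] by (simp add: W_def bilinear scaleR_2)
  qed
  have ww: "w \<odot> w \<in> W"
  proof -
    show ?thesis
      using Ph_Ph(1)[of w w] Ph_cube[of w] w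
      by (simp add: W_def P1_def S_closed commute[of "w \<odot> w" w])
  qed
  \<comment> \<open>With radius 1/2, \<open>F t\<close> maps \<open>Y\<close> into itself, since
    (1/2 + 1/4)/2 is at most 1/2, and contracts by the factor 1/2.\<close>
  define Y where "Y = W \<inter> cball 0 (1/2)"
  have "closed W"
    unfolding W_def Collect_conj_eq Collect_mem_eq
    by (intro closed_Int S_complete closed_Collect_eq continuous_intros bounded.continuous_on)
  then have Y: "complete Y" "Y \<noteq> {}"
    using W_scale[OF ww, of 0] by (auto simp: Y_def complete_eq_closed)
  define F where "F t y = (1/2) *\<^sub>R ((t\<^sup>2) *\<^sub>R (w \<odot> w) + y \<odot> y)" for t :: real and y
  have square_diff: "norm (y \<odot> y - z \<odot> z) \<le> norm (y - z)" if "y \<in> Y" "z \<in> Y" for y z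
  proof -
    have "y \<odot> y - z \<odot> z = (y - z) \<odot> (y + z)"
      by (simp add: bilinear commute)
    then have "norm (y \<odot> y - z \<odot> z) \<le> norm (y - z) * norm (y + z)"
      using norm_jprod by metis
    also have "norm (y + z) \<le> 1"
      using norm_triangle_ineq[of y z] that by (auto simp: Y_def)
    finally show ?thesis by (simp add: mult_left_le mult_left_mono)
  qed
  have "\<exists>!y\<in>Y. F t y = y" if t: "t \<in> {0..1}" for t
  proof (rule Banach_fix[OF Y, of "1/2"])
    show "F t ` Y \<subseteq> Y"
    proof (rule image_subsetI)
      fix y assume y: "y \<in> Y"
      have "norm ((t\<^sup>2) *\<^sub>R (w \<odot> w) + y \<odot> y) \<le> norm ((t\<^sup>2) *\<^sub>R (w \<odot> w)) + norm (y \<odot> y)"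
        by (rule norm_triangle_ineq)
      also have "norm ((t\<^sup>2) *\<^sub>R (w \<odot> w)) \<le> 1 * (1/2)"
        unfolding norm_scaleR using t w(2) by (intro mult_mono) (auto simp: power_le_one)
      also have "norm (y \<odot> y) \<le> norm y * norm y" by (rule norm_jprod)
      also have "\<dots> \<le> 1/2 * (1/2)"
        using y by (intro mult_mono) (auto simp: Y_def)
      finally show "F t y \<in> Y"
        using y by (auto simp: Y_def F_def intro!: W_scale W_add W_square ww)
    qed
  next
    fix y z assume yz: "y \<in> Y" "z \<in> Y"
    have "F t y - F t z = (1/2) *\<^sub>R (y \<odot> y - z \<odot> z)"
      by (simp add: F_def algebra_simps)
    then show "dist (F t y) (F t z) \<le> 1/2 * dist y z"
      using square_diff[OF yz] by (simp add: dist_norm)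
  qed auto
  then obtain y where yY: "\<And>t. t \<in> {0..1} \<Longrightarrow> y t \<in> Y" and yF: "\<And>t. t \<in> {0..1} \<Longrightarrow> F t (y t) = y t"
    by metis
  have "norm (y t - y s) \<le> 2 * norm (t - s)" if ts: "t \<in> {0..1}" "s \<in> {0..1}" for t s
  proof -
    have "y t - y s = F t (y t) - F s (y s)" using yF ts by simp
    also have "\<dots> = (1/2) *\<^sub>R ((t\<^sup>2 - s\<^sup>2) *\<^sub>R (w \<odot> w) + (y t \<odot> y t - y s \<odot> y s))"
      by (simp add: F_def algebra_simps)
    \<comment> \<open>The difference of the fixed points reappears on the right with factor 1/2 and
      is absorbed on the left.\<close>
    finally have "norm (y t - y s) \<le> 1/2 * (norm ((t\<^sup>2 - s\<^sup>2) *\<^sub>R (w \<odot> w)) + norm (y t - y s))"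
      using norm_triangle_ineq[of "(t\<^sup>2 - s\<^sup>2) *\<^sub>R (w \<odot> w)" "y t \<odot> y t - y s \<odot> y s"]
        square_diff[OF yY yY, OF ts] by simp
    then have "norm (y t - y s) \<le> \<bar>t\<^sup>2 - s\<^sup>2\<bar> * norm (w \<odot> w)" by simp
    also have "\<dots> \<le> \<bar>t\<^sup>2 - s\<^sup>2\<bar> * 1"
      using w(2) by (intro mult_left_mono) auto
    also have "t\<^sup>2 - s\<^sup>2 = (t + s) * (t - s)" by (simp add: power2_eq_square algebra_simps)
    also have "\<bar>(t + s) * (t - s)\<bar> * 1 \<le> 2 * \<bar>t - s\<bar>"
      using ts by (auto simp: abs_mult intro!: mult_right_mono)
    finally show ?thesis by simp
  qed
  then have "lipschitz_on 2 {0..1} y"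
    by (intro lipschitz_onI) (auto simp: dist_norm)
  then have y_cont: "continuous_on {0..1} y"
    by (rule lipschitz_on_continuous_on)
  \<comment> \<open>Expanding half of \<open>e\<close> plus the symmetry cancels
    \<open>e\<close>.\<close>
  define q where "q t = p + (1/2) *\<^sub>R (y t - 2 *\<^sub>R (p \<odot> y t) + t *\<^sub>R w)" for t
  have "continuous_on {0..1} q"
    unfolding q_def by (intro continuous_intros bounded.continuous_on y_cont)
  moreover have "q 0 = p"
  proof -
    have "y 0 = (1/2) *\<^sub>R (y 0 \<odot> y 0)" using yF[of 0] by (simp add: F_def)
    then have "norm (y 0) = 1/2 * norm (y 0 \<odot> y 0)" by (metis norm_scaleR abs_of_nonneg zero_le_divide_1_iff zero_le_numeral)
    also have "norm (y 0 \<odot> y 0) \<le> norm (y 0) * norm (y 0)" by (rule norm_jprod)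
    also have "\<dots> \<le> norm (y 0) * 1"
      using yY[of 0] by (intro mult_left_mono) (auto simp: Y_def)
    finally have "y 0 = 0" by simp
    then show ?thesis by (simp add: q_def)
  qed
  moreover have "\<forall>t\<in>{0..1}. q t \<in> S \<and> q t \<odot> q t = q t"
  proof (intro ballI conjI)
    fix t :: real assume t: "t \<in> {0..1}"
    have yt: "y t \<in> W" using yY[OF t] by (simp add: Y_def)
    show "q t \<in> S"
      using yt w p_in_S by (auto simp: q_def W_def intro!: S_add S_diff S_scale S_closed)
    define a b where "a = p \<odot> y t" and "b = y t - p \<odot> y t"
    have ab: "a \<in> P1" "b \<in> P0" "b \<odot> w = a \<odot> w" "y t = a + b"
      using W_parts[OF yt] yt by (auto simp: a_def b_def W_def diff_left scaleR_2 algebra_simps)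
    \<comment> \<open>This is \<open>2 *\<^sub>R q t\<close>, so idempotence becomes
      \<open>z \<odot> z = z + z\<close>. The cross terms with \<open>w\<close> cancel because
      \<open>a\<close> and \<open>b\<close> act alike on it.\<close>
    define z where "z = 2 *\<^sub>R p - a + b + t *\<^sub>R w"
    have p_left: "p \<odot> a = a" "p \<odot> b = 0" "p \<odot> w = (1/2) *\<^sub>R w" "a \<odot> b = 0"
      using ab w P1_P0[OF ab(1,2)] by (simp_all add: P1_def P0_def Ph_def)
    then have p_right: "a \<odot> p = a" "b \<odot> p = 0" "w \<odot> p = (1/2) *\<^sub>R w" "b \<odot> a = 0"
      "w \<odot> a = a \<odot> w" "w \<odot> b = a \<odot> w"
      using ab(3) commute by metis+
    have P: "(2 *\<^sub>R p) \<odot> a = a + a" "a \<odot> (2 *\<^sub>R p) = a + a" "(2 *\<^sub>R p) \<odot> b = 0" "b \<odot> (2 *\<^sub>R p) = 0"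
      "(2 *\<^sub>R p) \<odot> w = w" "w \<odot> (2 *\<^sub>R p) = w" "(2 *\<^sub>R p) \<odot> (2 *\<^sub>R p) = 2 *\<^sub>R p + 2 *\<^sub>R p"
      by (simp_all add: scaleR_left scaleR_right p_left p_right idem flip: scaleR_2)
    have "a + b = (1/2) *\<^sub>R ((t\<^sup>2) *\<^sub>R (w \<odot> w) + (a \<odot> a + b \<odot> b))"
      using yF[OF t] by (simp add: F_def ab(4) add_left add_right p_left p_right)
    then have "2 *\<^sub>R (a + b) = (t\<^sup>2) *\<^sub>R (w \<odot> w) + (a \<odot> a + b \<odot> b)" by simp
    then have square: "(t * t) *\<^sub>R (w \<odot> w) = a + a + b + b - a \<odot> a - b \<odot> b"
      by (simp add: scaleR_2 power2_eq_square algebra_simps)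
    define P where "P = 2 *\<^sub>R p"
    have "z \<odot> z = z + z"
      using P square p_left(4) p_right(4-6) ab(3) unfolding z_def P_def[symmetric]
      by (simp add: bilinear algebra_simps)
    moreover have "q t = (1/2) *\<^sub>R z"
    proof -
      have "y t - 2 *\<^sub>R (p \<odot> y t) = b - a" by (simp add: a_def b_def scaleR_2)
      then show ?thesis unfolding q_def z_def by (simp only:) (simp add: algebra_simps)
    qed
    ultimately show "q t \<odot> q t = q t"
      by (simp add: bilinear flip: scaleR_2)
  qed
  moreover have "ch (q 1) = (1/2) *\<^sub>R w"
  proof -
    have y1: "y 1 \<in> W" using yY[of 1] by (simp add: Y_def)
    have "q 1 = (p - (1/2) *\<^sub>R (p \<odot> y 1)) + (1/2) *\<^sub>R w + (1/2) *\<^sub>R (y 1 - p \<odot> y 1)"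
      by (simp add: q_def scaleR_2 algebra_simps)
    moreover have "p \<in> P1" by (simp add: P1_def idem)
    ultimately show ?thesis
      using W_parts[OF y1] w by (simp add: component_eqI P1_Ph_P0_closed)
  qed
  ultimately show ?thesis by (intro exI[of _ q] conjI)
qed

lemma prime_measure_nonextendable:
  assumes w: "w \<in> Ph \<inter> S" "w \<noteq> 0"
  obtains M where "is_prime M"
    "\<And>f. bounded_linear f \<Longrightarrow> \<exists>q\<in>S. q \<odot> q = q \<and> f q \<noteq> complex_of_real (prime_measure M q)"
proof -
  define v where "v = (1 / (2 * norm w)) *\<^sub>R w"
  have v: "v \<in> Ph \<inter> S" "v \<noteq> 0" "norm v = 1/2"
    using w by (auto simp: v_def P1_Ph_P0_closed S_scale)
  have vv: "norm (v \<odot> v) \<le> 1/2"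
    using norm_jprod[of v v] v by simp
  obtain q where "continuous_on {0..1::real} q \<and> q 0 = p \<and> (\<forall>t\<in>{0..1}. q t \<in> S \<and> q t \<odot> q t = q t) \<and>
    ch (q 1) = (1/2) *\<^sub>R v"
    using projection_path[OF v(1) vv] ..
  then have q: "continuous_on {0..1} q" "q 0 = p"
    "\<forall>t\<in>{0..1}. q t \<in> S \<and> q t \<odot> q t = q t" "ch (q 1) = (1/2) *\<^sub>R v"
    by simp_all
  have q1: "q 1 \<in> S" "q 1 \<odot> q 1 = q 1" using q(3) by auto
  \<comment> \<open>If the component were \<open>p\<close>, idempotence of \<open>q 1\<close> would
    leave no room for the square of its non-zero half component.\<close>
  have "p - c1 (q 1) \<noteq> 0"
  proof
    assume "p - c1 (q 1) = 0"
    then have "p = p + p \<odot> (((1/2) *\<^sub>R v) \<odot> ((1/2) *\<^sub>R v))"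
      using component_jprod(1)[of "q 1" "q 1"] by (simp add: q1 q(4) idem)
    then have "p \<odot> (v \<odot> v) = 0" by (simp add: bilinear)
    then show False using Ph_square_zero v by blast
  qed
  then obtain M where M: "is_prime M" "p - c1 (q 1) \<notin> M"
    using prime_ideal_avoiding[OF A_closed(4)[OF A_closed(2) c1_in_A[OF q1(1)]]] by blast
  have "\<exists>q\<in>S. q \<odot> q = q \<and> f q \<noteq> complex_of_real (prime_measure M q)" if f: "bounded_linear f" for f
  proof (rule ccontr)
    assume "\<not> ?thesis"
    then have f_eq: "f (q t) = complex_of_real (prime_measure M (q t))" if "t \<in> {0..1}" for t
      using q(3) that by blast
    \<comment> \<open>A continuous function with at most three values on a connected set is
      constant. The measure, however, is 1 at \<open>p\<close> and 0 or 1/2 at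
      \<open>q 1\<close>.\<close>
    have "(\<lambda>t. f (q t)) constant_on {0..1}"
    proof (rule continuous_finite_range_constant)
      show "continuous_on {0..1} (\<lambda>t. f (q t))"
        using bounded_linear.continuous_on[OF f q(1)] .
      have "(\<lambda>t. f (q t)) ` {0..1} \<subseteq> complex_of_real ` {0, 1, 1/2}"
      proof (rule image_subsetI)
        fix t :: real assume "t \<in> {0..1}"
        moreover have "prime_measure M (q t) \<in> {0, 1, 1/2}" by (simp add: prime_measure_def)
        ultimately show "f (q t) \<in> complex_of_real ` {0, 1, 1/2}" using f_eq by (metis imageI)
      qed
      then show "finite ((\<lambda>t. f (q t)) ` {0..1})" using finite_subset by blast
    qed auto
    then have "f (q 0) = f (q 1)" by (auto simp: constant_on_def)
    then have "prime_measure M p = prime_measure M (q 1)"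
      using f_eq[of 0] f_eq[of 1] q(2) by simp
    moreover have "c1 p = p" by (simp add: c1_def idem scaleR_2)
    ultimately show False using M by (auto simp: prime_measure_def is_prime_def is_ideal_def split: if_splits)
  qed
  with M(1) show ?thesis by (rule that)
qed

end

section \<open>JB*-algebras of type $I_2$\<close>

context jb_star_algebra
begin

sublocale jordan_algebra "(\<odot>)"
proof
  show "(r *\<^sub>R a) \<odot> b = r *\<^sub>R (a \<odot> b)" for r a b
    by (metis jprod_scaleC_left scaleC_of_real)
qed (fact jprod_commute jprod_add_left jordan_identity)+

definition "self_adjoint = {x. star x = x}"

lemma scaleR_scaleC: "r *\<^sub>R x = scaleC (complex_of_real r) x"
  by (simp add: scaleC_of_real)

lemma star_scaleR: "star (r *\<^sub>R x) = r *\<^sub>R star x"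
  by (simp add: scaleR_scaleC star_scaleC)

lemma subspace_self_adjoint: "real_vector.subspace self_adjoint"
proof (rule real_vector.subspaceI)
  show "0 \<in> self_adjoint"
    using star_scaleR[of 0 0] by (simp add: self_adjoint_def)
qed (auto simp: self_adjoint_def star_add star_scaleR)

text \<open>The three products in \<open>jordan_U\<close> bound the cube of the norm. The crude
  constant suffices for continuity of \<open>star\<close>.\<close>

lemma norm_le_norm_star: "norm a \<le> 3 * norm (star a)"
proof (cases "a = 0")
  case False
  let ?s = "star a"
  have tri: "norm ((x \<odot> y) \<odot> z) \<le> norm x * norm y * norm z" for x y z
    using norm_jprod[of "x \<odot> y" z] mult_right_mono[OF norm_jprod[of x y], of "norm z"] by simp
  have "norm a ^ 3 \<le> norm ((a \<odot> ?s) \<odot> a) + norm ((?s \<odot> a) \<odot> a) + norm ((a \<odot> a) \<odot> ?s)"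
    unfolding norm_U_star[symmetric] jordan_U_def
    using norm_triangle_ineq4[of "(a \<odot> ?s) \<odot> a + (?s \<odot> a) \<odot> a" "(a \<odot> a) \<odot> ?s"]
      norm_triangle_ineq[of "(a \<odot> ?s) \<odot> a" "(?s \<odot> a) \<odot> a"] by linarith
  also have "\<dots> \<le> norm a ^ 2 * (3 * norm ?s)"
    using tri[of a ?s a] tri[of ?s a a] tri[of a a ?s] by (simp add: power2_eq_square mult_ac)
  finally have "norm a ^ 2 * norm a \<le> norm a ^ 2 * (3 * norm ?s)"
    by (simp add: power2_eq_square power3_eq_cube)
  then show ?thesis using False by (simp add: mult_le_cancel_left)
qed simp

lemma closed_self_adjoint: "closed self_adjoint"
proof -
  have "bounded_linear star"
    using norm_le_norm_star[of "star x" for x]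
    by (intro bounded_linear_intro[of _ 3]) (auto simp: star_add star_scaleR star_star mult.commute)
  then show ?thesis
    unfolding self_adjoint_def
    by (intro closed_Collect_eq linear_continuous_on continuous_on_id)
qed

text \<open>For self-adjoint \<open>x\<close> the element in \<open>norm_U_star\<close> is the cube
  of \<open>x\<close>.\<close>

lemma self_adjoint_square_zero:
  assumes "x \<in> self_adjoint" "x \<odot> x = 0"
  shows "x = 0"
  using norm_U_star[of x] assms by (simp add: self_adjoint_def jordan_U_def)

text \<open>\<open>jordan_U (\<odot>) p p\<close> fixes every \<open>v\<close> with
  \<open>p \<odot> v = v\<close>, so such elements lie in its range.\<close>

lemma abelian_projection_assoc:
  assumes "is_abelian (\<odot>) p" "p \<odot> p = p" "p \<odot> x = x" "p \<odot> y = y" "p \<odot> z = z"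
  shows "(x \<odot> y) \<odot> z = x \<odot> (y \<odot> z)"
proof -
  have "jordan_U (\<odot>) p p v = v" if "p \<odot> v = v" for v
    using that assms(2) by (simp add: jordan_U_def commute)
  then have "x \<in> range (jordan_U (\<odot>) p p)" "y \<in> range (jordan_U (\<odot>) p p)"
    "z \<in> range (jordan_U (\<odot>) p p)"
    using assms(3-5) by (metis rangeI)+
  then show ?thesis using assms(1) unfolding is_abelian_def by blast
qed

text \<open>Real and imaginary parts of elements of \<open>Ph\<close> stay in \<open>Ph\<close>. If
  all self-adjoint ones vanish, the algebra is the direct sum of \<open>P1\<close> and
  \<open>P0\<close>, and \<open>p\<close> is central.\<close>

lemma peirce_half_nonzero:
  assumes p: "p \<in> projections (\<odot>) star" and "\<not> p \<in> centre (\<odot>)"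
  obtains w where "w \<in> self_adjoint" "w \<in> peirce.Ph (\<odot>) p" "w \<noteq> 0"
proof -
  have p: "star p = p" "p \<odot> p = p" using p by (auto simp: projections_def)
  interpret peirce jprod p by unfold_locales (fact p)
  show ?thesis
  proof (rule ccontr)
    assume "\<not> thesis"
    with that have no: "w = 0" if "w \<in> Ph" "w \<in> self_adjoint" for w using that by blast
    have zero: "u = 0" if "u \<in> Ph" for u
    proof -
      have star_Ph: "star u \<in> Ph"
        using that star_jprod[of p u] p by (simp add: Ph_def star_scaleR)
      have "scaleC \<i> (u - star u) \<in> Ph"
      proof -
        have "p \<odot> scaleC \<i> (u - star u) = scaleC \<i> (p \<odot> (u - star u))"
          using jprod_scaleC_left commute by metis
        also have "p \<odot> (u - star u) = (1/2) *\<^sub>R (u - star u)"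
          using P1_Ph_P0_closed(8)[OF that star_Ph] by (simp add: Ph_def)
        finally show ?thesis
          by (simp add: Ph_def scaleR_scaleC mult.commute)
      qed
      moreover have "scaleC \<i> (u - star u) \<in> self_adjoint"
      proof -
        have "star (u - star u) = - (u - star u)"
          using star_add[of u "(-1) *\<^sub>R star u"] star_scaleR[of "-1" "star u"] by (simp add: star_star)
        then have "star (scaleC \<i> (u - star u)) = scaleC (- \<i>) (- (u - star u))"
          by (simp add: star_scaleC)
        then show ?thesis
          unfolding self_adjoint_def scale_minus_left scale_minus_right by simp
      qed
      ultimately have "scaleC \<i> (u - star u) = 0" using no by blast
      then have "u = star u" by simp
      moreover have "u + star u \<in> self_adjoint"
        by (simp add: self_adjoint_def star_add star_star add.commute)
      then have "u + star u = 0"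
        using no P1_Ph_P0_closed(5)[OF \<open>u \<in> Ph\<close> star_Ph] by blast
      ultimately have "2 *\<^sub>R u = 0" by (simp add: scaleR_2)
      then show "u = 0" by simp
    qed
    have split: "x = c1 x + c0 x" for x
      using decomposition[of x] zero[OF components(2)] by simp
    have pc: "p \<odot> x = c1 x" for x
      using arg_cong[OF split[of x], of "(\<odot>) p"] components[of x] by (simp add: add_right P1_def P0_def)
    have "(p \<odot> c) \<odot> b = p \<odot> (c \<odot> b)" for b c
    proof -
      have "p \<odot> (c \<odot> b) = p \<odot> (c1 c \<odot> b) + p \<odot> (c0 c \<odot> b)"
        using split[of c] by (metis add_left add_right)
      also have "\<dots> = c1 c \<odot> c1 b + c0 c \<odot> c1 b"
        using commutes_with_p[of "c1 c" b] commutes_with_p[of "c0 c" b] components[of c] by (simp add: pc)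
      also have "c0 c \<odot> c1 b = 0"
        using P1_P0[OF components(1,3)] commute by metis
      also have "c1 c \<odot> c1 b + 0 = c1 c \<odot> (c1 b + c0 b)"
        using P1_P0[OF components(1,3)] by (simp add: add_right)
      finally show ?thesis using split[of b] by (simp add: pc)
    qed
    then show False using assms(2) by (simp add: centre_def)
  qed
qed

lemma type_I2_measure_without_extension:
  assumes "\<exists>x::'a. x \<noteq> 0" and "type_I2 (\<odot>) star"
  shows "\<exists>\<mu>. positive_fin_additive_measure (\<odot>) star \<mu> \<and>
    \<not> extends_to_bounded_functional scaleC (\<odot>) star \<mu>"
proof -
  obtain e p p' where unit: "\<And>x. e \<odot> x = x"
    and proj: "p \<in> projections (\<odot>) star" "p' \<in> projections (\<odot>) star"
    and abelian: "is_abelian (\<odot>) p" "is_abelian (\<odot>) p'"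
    and cover: "is_central_cover (\<odot>) star p e" "is_central_cover (\<odot>) star p' e"
    and sum: "p + p' = e"
    using assms(2) unfolding type_I2_def is_unit_def by blast
  have p: "star p = p" "p \<odot> p = p" and p': "star p' = p'" "p' \<odot> p' = p'"
    using proj by (auto simp: projections_def)
  have p'_eq: "p' = e - p" using sum by (simp add: algebra_simps)
  have star_e: "star e = e" using p(1) p'(1) sum star_add by metis
  interpret peirce jprod p by unfold_locales (fact p)
  interpret banach_frame jprod p self_adjoint e
  proof
    show "(a \<odot> b) \<odot> c = a \<odot> (b \<odot> c)"
      if "a \<in> P1 \<inter> self_adjoint" "b \<in> P1 \<inter> self_adjoint" "c \<in> P1 \<inter> self_adjoint" for a b c
      using that p by (intro abelian_projection_assoc[OF abelian(1)]) (auto simp: P1_def)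
    show "(a \<odot> b) \<odot> c = a \<odot> (b \<odot> c)"
      if "a \<in> P0 \<inter> self_adjoint" "b \<in> P0 \<inter> self_adjoint" "c \<in> P0 \<inter> self_adjoint" for a b c
      using that p' by (intro abelian_projection_assoc[OF abelian(2)]) (auto simp: P0_def p'_eq diff_left unit)
    show "x = 0" if "x \<in> self_adjoint" "x \<odot> x = 0" for x
      using self_adjoint_square_zero that .
    show "real_vector.subspace self_adjoint" "closed self_adjoint"
      by (fact subspace_self_adjoint closed_self_adjoint)+
  qed (use p star_e in \<open>simp_all add: norm_jprod unit self_adjoint_def star_jprod\<close>)
  \<comment> \<open>A central \<open>p\<close> would be its own central cover, so
    \<open>p = e\<close> and \<open>p' = 0\<close>. The central cover of 0 is 0, which forces
    \<open>e = 0\<close> and a zero algebra.\<close>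
  have "p \<notin> centre (\<odot>)"
  proof
    assume "p \<in> centre (\<odot>)"
    then have "e \<odot> p = e"
      using cover(1) proj p by (simp add: is_central_cover_def proj_le_def)
    then have "p' = 0" by (simp add: unit p'_eq)
    moreover have "0 \<in> projections (\<odot>) star \<inter> centre (\<odot>)"
      using S_0 by (simp add: projections_def centre_def self_adjoint_def)
    then have "p' \<odot> 0 = p' \<longrightarrow> e \<odot> 0 = e"
      using cover(2) unfolding is_central_cover_def proj_le_def by blast
    ultimately have "e \<odot> 0 = e" by simp
    then show False using assms(1) unit by (metis zero_left zero_right)
  qed
  then obtain w where "w \<in> self_adjoint" "w \<in> Ph" "w \<noteq> 0"
    using peirce_half_nonzero[OF proj(1)] by blast
  then obtain M where M: "is_prime M"
    and no_ext: "\<And>f. bounded_linear f \<Longrightarrow>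
      \<exists>q\<in>self_adjoint. q \<odot> q = q \<and> f q \<noteq> complex_of_real (prime_measure M q)"
    using prime_measure_nonextendable by blast
  have "positive_fin_additive_measure (\<odot>) star (prime_measure M)"
    unfolding positive_fin_additive_measure_def projections_def
  proof (intro conjI ballI impI)
    show "0 \<le> prime_measure M q" for q by (simp add: prime_measure_def)
  next
    fix q r assume "q \<in> {p. star p = p \<and> p \<odot> p = p}" "r \<in> {p. star p = p \<and> p \<odot> p = p}" "q \<odot> r = 0"
    then show "prime_measure M (q + r) = prime_measure M q + prime_measure M r"
      by (intro prime_measure_add[OF M]) (simp_all add: self_adjoint_def)
  qed
  moreover have "\<not> extends_to_bounded_functional scaleC (\<odot>) star (prime_measure M)"
  proof
    assume "extends_to_bounded_functional scaleC (\<odot>) star (prime_measure M)"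
    then obtain f where "bounded_linear f"
      and "\<And>q. star q = q \<Longrightarrow> q \<odot> q = q \<Longrightarrow> f q = complex_of_real (prime_measure M q)"
      unfolding extends_to_bounded_functional_def bounded_complex_functional_def projections_def by blast
    then show False using no_ext[of f] unfolding self_adjoint_def by blast
  qed
  ultimately show ?thesis by blast
qed

end

theorem mainTheorem8:
  fixes scaleC :: "complex \<Rightarrow> 'a::banach \<Rightarrow> 'a"
    and jprod :: "'a \<Rightarrow> 'a \<Rightarrow> 'a"
    and star :: "'a \<Rightarrow> 'a"
    and scaleX :: "complex \<Rightarrow> 'x::banach \<Rightarrow> 'x"
    and T :: "'a \<Rightarrow> 'x \<Rightarrow>\<^sub>L complex"
  assumes "jbw_star_algebra scaleC jprod star scaleX T"
    and "\<exists>x::'a. x \<noteq> 0"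
    and "type_I2 jprod star"
  shows "\<exists>\<mu> :: 'a \<Rightarrow> real. positive_fin_additive_measure jprod star \<mu> \<and>
           \<not> extends_to_bounded_functional scaleC jprod star \<mu>"
proof -
  interpret jbw_star_algebra scaleC jprod star scaleX T by (fact assms(1))
  show ?thesis by (rule type_I2_measure_without_extension[OF assms(2,3)])
qed

end
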